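(* Let $Q$ be a commutative unital quantale. For every $Q$-context $(X,Y,\alpha)$, i.e. every pair of sets $X,Y$ with a $Q$-relation $\alpha\colon X\nrightarrow Y$, there is a canonical isomorphism of $Q$-categories $$\mathfrak{B}(X,Y,\alpha)\;\cong\;\mathfrak{B}\alpha ,\qquad (\lambda,\sigma)\mapsto\sigma,$$ between the formal concept lattice of $(X,Y,\alpha)$ and $\mathfrak{B}\alpha=\mathbf{B}(Q\text{-}\mathbf{Rel})(\alpha,\tau)$. Consequently, the formal concept lattice construction $(X,Y,\alpha)\mapsto\mathfrak{B}(X,Y,\alpha)$ is functorial over $\mathbf{B}(Q\text{-}\mathbf{Rel})^{\mathrm{op}}$, i.e. via these isomorphisms it is the object assignment of a functor $\mathbf{B}(Q\text{-}\mathbf{Rel})^{\mathrm{op}}\to Q\text{-}\mathbf{Sup}$ isomorphic to the representable functor $\mathfrak{B}=\mathbf{B}(Q\text{-}\mathbf{Rel})(-,\tau)$.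
   Context: A commutative unital quantale $Q$ is a complete lattice with a commutative associative operation $\&$ with unit $\mathrm{k}$ distributing over arbitrary joins in each variable; $a\to(-)$ is the right adjoint of $a\&(-)$. A $Q$-relation $\alpha\colon X\nrightarrow Y$ is a map $X\times Y\to Q$, ordered pointwise. For $\alpha\colon X\nrightarrow Y$, $\beta\colon Y\nrightarrow Z$, $\gamma\colon X\nrightarrow Z$: $(\beta\circ\alpha)(x,z)=\bigvee_{y}\beta(y,z)\&\alpha(x,y)$, $(\gamma\swarrow\alpha)(y,z)=\bigwedge_{x}\alpha(x,y)\to\gamma(x,z)$, $(\beta\searrow\gamma)(x,y)=\bigwedge_{z}\beta(y,z)\to\gamma(x,z)$. Scalar implication: $(q\to\alpha)(x,y)=q\to\alpha(x,y)$. $Q$-relations $\{\star\}\nrightarrow\{\star\}$ are identified with elements of $Q$. A $Q$-category $\mathbb{A}$ is a set $\mathbb{A}_0$ with $\mathbb{A}\colon\mathbb{A}_0\times\mathbb{A}_0\to Q$ such that $\mathrm{k}\le\mathbb{A}(x,x)$ and $\mathbb{A}(y,z)\&\mathbb{A}(x,y)\le\mathbb{A}(x,z)$; its underlying preorder is $x\le y\iff\mathrm{k}\le\mathbb{A}(x,y)$, and $\mathbb{A}$ is skeletal if this is a partial order. A $Q$-functor is a map $F$ with $\mathbb{A}(x,y)\le\mathbb{B}(Fx,Fy)$; $F\dashv G$ means $\mathbb{B}(Fx,y)=\mathbb{A}(x,Gy)$. $\mathbb{A}$ is cocomplete if its Yoneda embedding into the $Q$-category of presheaves has a left adjoint. $Q\text{-}\mathbf{Sup}$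 is the category of skeletal cocomplete $Q$-categories and left adjoint $Q$-functors. Skeletal cocomplete $Q$-categories correspond to $Q$-modules, i.e. complete lattices with an action $q\cdot x$ of the monoid $(Q,\&,\mathrm{k})$ preserving joins in each variable, via $\mathbb{A}(x,y)=\bigvee\{q\in Q\mid q\cdot x\le y\}$; left adjoint $Q$-functors correspond to maps preserving joins and the action. A formal concept of $(X,Y,\alpha)$ is a pair $(\lambda\colon X\nrightarrow\{\star\},\ \sigma\colon\{\star\}\nrightarrow Y)$ with $\lambda=\sigma\searrow\alpha$ and $\sigma=\alpha\swarrow\lambda$. The formal concept lattice $\mathfrak{B}(X,Y,\alpha)$ is the skeletal cocomplete $Q$-category of all formal concepts, with hom $\mathfrak{B}(X,Y,\alpha)((\lambda,\sigma),(\mu,\rho))=\mu\swarrow\lambda=\rho\searrow\sigma$. The back-diagonal category $\mathbf{B}(Q\text{-}\mathbf{Rel})$ has all $Q$-relations as objects; a morphism from $\alpha\colon X\nrightarrow Y$ to $\beta\colon X'\nrightarrow Y'$ is a $Q$-relation $f\colon X'\nrightarrow Y$ with $\alpha\swarrow(f\searrow\alpha)=f=(\beta\swarrow f)\searrow\beta$ (equivalently, $f=\alpha\swarrow u=v\searrow\beta$ for some $u\colon X\nrightarrow X'$, $v\colon Y\nrightarrow Y'$). The composite of $f\colon\alpha\to\beta$ and $g\colon\beta\to\gamma$ is $g\bullet f=(\beta\swarrow f)\searrow g=f\swarrow(g\searrow\beta)$, and the identity on $\alpha$ is $\alpha$. Hom-sets carry the opposite of the pointwise order and the $Q$-action $q\cdot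 f=q\to f$; this makes $\mathbf{B}(Q\text{-}\mathbf{Rel})$ enriched in $Q\text{-}\mathbf{Sup}$. $\tau\colon\{\star\}\nrightarrow Q$ is the $Q$-relation $\tau(\star,q)=q$. The functor $\mathfrak{B}=\mathbf{B}(Q\text{-}\mathbf{Rel})(-,\tau)\colon\mathbf{B}(Q\text{-}\mathbf{Rel})^{\mathrm{op}}\to Q\text{-}\mathbf{Sup}$ sends $\alpha$ to $\mathfrak{B}\alpha=\mathbf{B}(Q\text{-}\mathbf{Rel})(\alpha,\tau)$ and $f\colon\alpha\to\beta$ to $\mathfrak{B}f\colon\mathfrak{B}\beta\to\mathfrak{B}\alpha$, $\mathfrak{B}f(\sigma)=\sigma\bullet f$. *)

theory Defs
  imports Main "HOL-Library.FuncSet"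
begin

section \<open>Commutative unital quantales\<close>

text \<open>The tensor is \<open>*\<close> and the unit \<open>k\<close> is \<open>1\<close>; by commutativity one distributive law suffices.\<close>

class comm_quantale = complete_lattice + comm_monoid_mult +
  assumes mult_Sup_distrib: "a * Sup S = (SUP s\<in>S. a * s)"

definition qimp :: "'q::comm_quantale \<Rightarrow> 'q \<Rightarrow> 'q"  (infixr \<open>\<rightarrow>\<^sub>Q\<close> 65)
  where "a \<rightarrow>\<^sub>Q b = Sup {c. a * c \<le> b}"

lemma qmult_right_mono: "(b::'q::comm_quantale) \<le> c \<Longrightarrow> a * b \<le> a * c"
  using mult_Sup_distrib[of a "{b, c}"] by (simp add: le_iff_sup sup.absorb2)

lemma qimp_adjoint: "a * c \<le> b \<longleftrightarrow> c \<le> a \<rightarrow>\<^sub>Q b" for a b c :: "'q::comm_quantale"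
proof
  assume "a * c \<le> b"
  then show "c \<le> a \<rightarrow>\<^sub>Q b"
    unfolding qimp_def by (simp add: Sup_upper)
next
  assume "c \<le> a \<rightarrow>\<^sub>Q b"
  then have "a * c \<le> a * Sup {c. a * c \<le> b}"
    unfolding qimp_def by (rule qmult_right_mono)
  also have "\<dots> \<le> b"
    by (auto simp: mult_Sup_distrib intro: SUP_least)
  finally show "a * c \<le> b" .
qed


section \<open>Q-relations\<close>

text \<open>
  A Q-relation carries its domain \<open>X\<close> and codomain \<open>Y\<close>. Its values outside \<open>X \<times> Y\<close> are
  fixed to \<^const>\<open>undefined\<close>, so that two Q-relations are equal as records iff they agree as
  maps \<open>X \<times> Y \<rightarrow> Q\<close>.
\<close>

record ('a, 'b, 'q) qrel =
  rdom :: "'a set"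
  rcod :: "'b set"
  rval :: "'a \<times> 'b \<Rightarrow> 'q"

definition is_qrel :: "('a, 'b, 'q) qrel \<Rightarrow> bool"
  where "is_qrel \<alpha> \<longleftrightarrow> rval \<alpha> \<in> extensional (rdom \<alpha> \<times> rcod \<alpha>)"

definition qrel_le :: "('a, 'b, 'q::comm_quantale) qrel \<Rightarrow> ('a, 'b, 'q) qrel \<Rightarrow> bool"
  where "qrel_le \<alpha> \<beta> \<longleftrightarrow> rdom \<alpha> = rdom \<beta> \<and> rcod \<alpha> = rcod \<beta> \<and>
    (\<forall>x\<in>rdom \<alpha>. \<forall>y\<in>rcod \<alpha>. rval \<alpha> (x, y) \<le> rval \<beta> (x, y))"

definition qrel_comp ::
    "('b, 'c, 'q::comm_quantale) qrel \<Rightarrow> ('a, 'b, 'q) qrel \<Rightarrow> ('a, 'c, 'q) qrel"  (infixl \<open>\<circ>\<^sub>Q\<close> 70)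
  where "\<beta> \<circ>\<^sub>Q \<alpha> = \<lparr> rdom = rdom \<alpha>, rcod = rcod \<beta>,
    rval = (\<lambda>(x, z)\<in>rdom \<alpha> \<times> rcod \<beta>. SUP y\<in>rcod \<alpha>. rval \<beta> (y, z) * rval \<alpha> (x, y)) \<rparr>"

definition qrel_sw ::
    "('a, 'c, 'q::comm_quantale) qrel \<Rightarrow> ('a, 'b, 'q) qrel \<Rightarrow> ('b, 'c, 'q) qrel"  (infix \<open>\<swarrow>\<close> 65)
  where "\<gamma> \<swarrow> \<alpha> = \<lparr> rdom = rcod \<alpha>, rcod = rcod \<gamma>,
    rval = (\<lambda>(y, z)\<in>rcod \<alpha> \<times> rcod \<gamma>. INF x\<in>rdom \<alpha>. rval \<alpha> (x, y) \<rightarrow>\<^sub>Q rval \<gamma> (x, z)) \<rparr>"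

definition qrel_se ::
    "('b, 'c, 'q::comm_quantale) qrel \<Rightarrow> ('a, 'c, 'q) qrel \<Rightarrow> ('a, 'b, 'q) qrel"  (infix \<open>\<searrow>\<close> 65)
  where "\<beta> \<searrow> \<gamma> = \<lparr> rdom = rdom \<gamma>, rcod = rdom \<beta>,
    rval = (\<lambda>(x, y)\<in>rdom \<gamma> \<times> rdom \<beta>. INF z\<in>rcod \<beta>. rval \<beta> (y, z) \<rightarrow>\<^sub>Q rval \<gamma> (x, z)) \<rparr>"

definition qrel_imp :: "'q::comm_quantale \<Rightarrow> ('a, 'b, 'q) qrel \<Rightarrow> ('a, 'b, 'q) qrel"
  where "qrel_imp q \<alpha> = \<lparr> rdom = rdom \<alpha>, rcod = rcod \<alpha>,
    rval = (\<lambda>(x, y)\<in>rdom \<alpha> \<times> rcod \<alpha>. q \<rightarrow>\<^sub>Q rval \<alpha> (x, y)) \<rparr>"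


section \<open>Q-categories\<close>

text \<open>A Q-category is a Q-relation from its set of objects to itself.\<close>

type_synonym ('c, 'q) qcat = "('c, 'c, 'q) qrel"

abbreviation qobj :: "('c, 'q) qcat \<Rightarrow> 'c set"
  where "qobj A \<equiv> rdom A"

definition is_qcat :: "('c, 'q::comm_quantale) qcat \<Rightarrow> bool"
  where "is_qcat A \<longleftrightarrow> is_qrel A \<and> rcod A = rdom A \<and>
    (\<forall>x\<in>qobj A. 1 \<le> rval A (x, x)) \<and>
    (\<forall>x\<in>qobj A. \<forall>y\<in>qobj A. \<forall>z\<in>qobj A. rval A (y, z) * rval A (x, y) \<le> rval A (x, z))"

definition skeletal :: "('c, 'q::comm_quantale) qcat \<Rightarrow> bool"
  where "skeletal A \<longleftrightarrow>
    (\<forall>x\<in>qobj A. \<forall>y\<in>qobj A. 1 \<le> rval A (x, y) \<and> 1 \<le> rval A (y, x) \<longrightarrow> x = y)"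

text \<open>Q-functors are extensional maps, so that equality of Q-functors is equality in HOL.\<close>

definition qfunctors :: "('c, 'q::comm_quantale) qcat \<Rightarrow> ('d, 'q) qcat \<Rightarrow> ('c \<Rightarrow> 'd) set"
  where "qfunctors A B = {F \<in> qobj A \<rightarrow>\<^sub>E qobj B.
    \<forall>x\<in>qobj A. \<forall>y\<in>qobj A. rval A (x, y) \<le> rval B (F x, F y)}"

definition qadjoint ::
    "('c, 'q::comm_quantale) qcat \<Rightarrow> ('d, 'q) qcat \<Rightarrow> ('c \<Rightarrow> 'd) \<Rightarrow> ('d \<Rightarrow> 'c) \<Rightarrow> bool"
  where "qadjoint A B F G \<longleftrightarrow> F \<in> qfunctors A B \<and> G \<in> qfunctors B A \<and>
    (\<forall>x\<in>qobj A. \<forall>y\<in>qobj B. rval B (F x, y) = rval A (x, G y))"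

definition left_adjoints :: "('c, 'q::comm_quantale) qcat \<Rightarrow> ('d, 'q) qcat \<Rightarrow> ('c \<Rightarrow> 'd) set"
  where "left_adjoints A B = {F. \<exists>G. qadjoint A B F G}"

definition qcat_iso ::
    "('c, 'q::comm_quantale) qcat \<Rightarrow> ('d, 'q) qcat \<Rightarrow> ('c \<Rightarrow> 'd) \<Rightarrow> bool"
  where "qcat_iso A B F \<longleftrightarrow> is_qcat A \<and> is_qcat B \<and> F \<in> qfunctors A B \<and>
    (\<exists>G\<in>qfunctors B A. (\<forall>x\<in>qobj A. G (F x) = x) \<and> (\<forall>y\<in>qobj B. F (G y) = y))"

text \<open>
  Presheaves on \<open>A\<close> are the Q-relations \<open>\<phi>\<close> from \<open>A\<close> to a singleton with
  \<open>\<phi>(y) * A(x, y) \<le> \<phi>(x)\<close>; their hom is \<open>\<psi> \<swarrow> \<phi>\<close>.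
\<close>

definition presheaves :: "('c, 'q::comm_quantale) qcat \<Rightarrow> ('c, unit, 'q) qrel set"
  where "presheaves A = {\<phi>. is_qrel \<phi> \<and> rdom \<phi> = qobj A \<and> rcod \<phi> = {()} \<and> qrel_le (\<phi> \<circ>\<^sub>Q A) \<phi>}"

definition presheaf_qcat :: "('c, 'q::comm_quantale) qcat \<Rightarrow> (('c, unit, 'q) qrel, 'q) qcat"
  where "presheaf_qcat A = \<lparr> rdom = presheaves A, rcod = presheaves A,
    rval = (\<lambda>(\<phi>, \<psi>)\<in>presheaves A \<times> presheaves A. rval (\<psi> \<swarrow> \<phi>) ((), ())) \<rparr>"

definition yoneda :: "('c, 'q::comm_quantale) qcat \<Rightarrow> 'c \<Rightarrow> ('c, unit, 'q) qrel"
  where "yoneda A = (\<lambda>a\<in>qobj A. \<lparr> rdom = qobj A, rcod = {()},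
    rval = (\<lambda>(x, _)\<in>qobj A \<times> {()}. rval A (x, a)) \<rparr>)"

definition cocomplete :: "('c, 'q::comm_quantale) qcat \<Rightarrow> bool"
  where "cocomplete A \<longleftrightarrow> (\<exists>L. qadjoint (presheaf_qcat A) A L (yoneda A))"

text \<open>
  The Q-category of a Q-module on the set \<open>M\<close> with order \<open>le\<close> and action \<open>act\<close>.
\<close>

definition module_qcat ::
    "'m set \<Rightarrow> ('m \<Rightarrow> 'm \<Rightarrow> bool) \<Rightarrow> ('q::comm_quantale \<Rightarrow> 'm \<Rightarrow> 'm) \<Rightarrow> ('m, 'q) qcat"
  where "module_qcat M le act = \<lparr> rdom = M, rcod = M,
    rval = (\<lambda>(x, y)\<in>M \<times> M. Sup {q. le (act q x) y}) \<rparr>"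


section \<open>Categories and functors\<close>

text \<open>
  Hom-sets of different pairs of objects may overlap, so composition and identities receive the
  objects as arguments: \<open>ccomp C a b c g f\<close> is the composite of \<open>f : a \<rightarrow> b\<close> and \<open>g : b \<rightarrow> c\<close>.
\<close>

record ('o, 'm) cat =
  cobj :: "'o set"
  chom :: "'o \<Rightarrow> 'o \<Rightarrow> 'm set"
  ccomp :: "'o \<Rightarrow> 'o \<Rightarrow> 'o \<Rightarrow> 'm \<Rightarrow> 'm \<Rightarrow> 'm"
  cid :: "'o \<Rightarrow> 'm"

definition is_cat :: "('o, 'm) cat \<Rightarrow> bool"
  where "is_cat C \<longleftrightarrow>
    (\<forall>a\<in>cobj C. cid C a \<in> chom C a a) \<and>
    (\<forall>a\<in>cobj C. \<forall>b\<in>cobj C. \<forall>c\<in>cobj C. \<forall>f\<in>chom C a b. \<forall>g\<in>chom C b c.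
      ccomp C a b c g f \<in> chom C a c) \<and>
    (\<forall>a\<in>cobj C. \<forall>b\<in>cobj C. \<forall>f\<in>chom C a b.
      ccomp C a a b f (cid C a) = f \<and> ccomp C a b b (cid C b) f = f) \<and>
    (\<forall>a\<in>cobj C. \<forall>b\<in>cobj C. \<forall>c\<in>cobj C. \<forall>d\<in>cobj C.
      \<forall>f\<in>chom C a b. \<forall>g\<in>chom C b c. \<forall>h\<in>chom C c d.
        ccomp C a c d h (ccomp C a b c g f) = ccomp C a b d (ccomp C b c d h g) f)"

definition op_cat :: "('o, 'm) cat \<Rightarrow> ('o, 'm) cat"
  where "op_cat C = \<lparr> cobj = cobj C, chom = (\<lambda>a b. chom C b a),
    ccomp = (\<lambda>a b c g f. ccomp C c b a f g), cid = cid C \<rparr>"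

record ('o, 'm, 'p, 'n) cfun =
  fobj :: "'o \<Rightarrow> 'p"
  fmor :: "'o \<Rightarrow> 'o \<Rightarrow> 'm \<Rightarrow> 'n"

definition is_cfun :: "('o, 'm) cat \<Rightarrow> ('p, 'n) cat \<Rightarrow> ('o, 'm, 'p, 'n) cfun \<Rightarrow> bool"
  where "is_cfun C D F \<longleftrightarrow> is_cat C \<and> is_cat D \<and>
    (\<forall>a\<in>cobj C. fobj F a \<in> cobj D) \<and>
    (\<forall>a\<in>cobj C. \<forall>b\<in>cobj C. \<forall>f\<in>chom C a b. fmor F a b f \<in> chom D (fobj F a) (fobj F b)) \<and>
    (\<forall>a\<in>cobj C. fmor F a a (cid C a) = cid D (fobj F a)) \<and>
    (\<forall>a\<in>cobj C. \<forall>b\<in>cobj C. \<forall>c\<in>cobj C. \<forall>f\<in>chom C a b. \<forall>g\<in>chom C b c.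
      fmor F a c (ccomp C a b c g f) =
        ccomp D (fobj F a) (fobj F b) (fobj F c) (fmor F b c g) (fmor F a b f))"

text \<open>Q-Sup, on the Q-categories with objects drawn from a type \<open>'c\<close>.\<close>

definition QSup :: "(('c, 'q::comm_quantale) qcat, 'c \<Rightarrow> 'c) cat"
  where "QSup = \<lparr> cobj = {A. is_qcat A \<and> skeletal A \<and> cocomplete A}, chom = left_adjoints,
    ccomp = (\<lambda>A B C G F. compose (qobj A) G F), cid = (\<lambda>A. (\<lambda>x\<in>qobj A. x)) \<rparr>"

text \<open>
  Natural isomorphism between two functors into Q-Sup whose values may have objects of different
  types \<open>'c\<close> and \<open>'d\<close>; each component is an invertible morphism of Q-Sup.
\<close>

definition QSup_nat_iso ::
    "('o, 'm) cat \<Rightarrow> ('o, 'm, ('c, 'q::comm_quantale) qcat, 'c \<Rightarrow> 'c) cfun \<Rightarrow>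
     ('o, 'm, ('d, 'q) qcat, 'd \<Rightarrow> 'd) cfun \<Rightarrow> ('o \<Rightarrow> 'c \<Rightarrow> 'd) \<Rightarrow> bool"
  where "QSup_nat_iso C F G \<eta> \<longleftrightarrow> is_cfun C QSup F \<and> is_cfun C QSup G \<and>
    (\<forall>a\<in>cobj C. \<eta> a \<in> left_adjoints (fobj F a) (fobj G a) \<and>
      (\<exists>\<theta>\<in>left_adjoints (fobj G a) (fobj F a).
        (\<forall>x\<in>qobj (fobj F a). \<theta> (\<eta> a x) = x) \<and> (\<forall>y\<in>qobj (fobj G a). \<eta> a (\<theta> y) = y))) \<and>
    (\<forall>a\<in>cobj C. \<forall>b\<in>cobj C. \<forall>f\<in>chom C a b.
      compose (qobj (fobj F a)) (fmor G a b f) (\<eta> a) =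
      compose (qobj (fobj F a)) (\<eta> b) (fmor F a b f))"


section \<open>The back-diagonal category of Q-relations\<close>

definition bd_hom ::
    "('a, 'b, 'q::comm_quantale) qrel \<Rightarrow> ('a, 'b, 'q) qrel \<Rightarrow> ('a, 'b, 'q) qrel set"
  where "bd_hom \<alpha> \<beta> = {f. is_qrel f \<and> rdom f = rdom \<beta> \<and> rcod f = rcod \<alpha> \<and>
    \<alpha> \<swarrow> (f \<searrow> \<alpha>) = f \<and> (\<beta> \<swarrow> f) \<searrow> \<beta> = f}"

definition BRel :: "(('a, 'b, 'q::comm_quantale) qrel, ('a, 'b, 'q) qrel) cat"
  where "BRel = \<lparr> cobj = {\<alpha>. is_qrel \<alpha>}, chom = bd_hom,
    ccomp = (\<lambda>\<alpha> \<beta> \<gamma> g f. (\<beta> \<swarrow> f) \<searrow> g), cid = (\<lambda>\<alpha>. \<alpha>) \<rparr>"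

text \<open>
  The hom-objects in Q-Sup: the order is the \<^emph>\<open>opposite\<close> of the pointwise one, and \<open>q\<close> acts by
  \<open>f \<mapsto> (q \<rightarrow> f)\<close>.
\<close>

definition BRel_hom :: "('a, 'b, 'q::comm_quantale) qrel \<Rightarrow> ('a, 'b, 'q) qrel \<Rightarrow>
    (('a, 'b, 'q) qrel, 'q) qcat"
  where "BRel_hom \<alpha> \<beta> = module_qcat (chom BRel \<alpha> \<beta>) (\<lambda>f g. qrel_le g f) qrel_imp"

text \<open>
  The sets in play are subsets of the universes \<open>'a\<close> (domains) and \<open>'b\<close> (codomains). For
  \<open>\<tau>\<close> to be an object, the one-point set is realised as \<open>{star}\<close> in \<open>'a\<close>, and the
  underlying set of \<open>Q\<close> as the range of an injection \<open>emb\<close> into \<open>'b\<close>.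
\<close>

definition tau :: "'a \<Rightarrow> ('q::comm_quantale \<Rightarrow> 'b) \<Rightarrow> ('a, 'b, 'q) qrel"
  where "tau star emb = \<lparr> rdom = {star}, rcod = range emb,
    rval = (\<lambda>(_, y)\<in>{star} \<times> range emb. the_inv emb y) \<rparr>"

definition BRel_repr :: "'a \<Rightarrow> ('q::comm_quantale \<Rightarrow> 'b) \<Rightarrow>
    (('a, 'b, 'q) qrel, ('a, 'b, 'q) qrel, (('a, 'b, 'q) qrel, 'q) qcat,
     ('a, 'b, 'q) qrel \<Rightarrow> ('a, 'b, 'q) qrel) cfun"
  where "BRel_repr star emb = \<lparr> fobj = (\<lambda>\<alpha>. BRel_hom \<alpha> (tau star emb)),
    fmor = (\<lambda>\<beta> \<alpha> f. \<lambda>\<sigma>\<in>chom BRel \<beta> (tau star emb). ccomp BRel \<alpha> \<beta> (tau star emb) \<sigma> f) \<rparr>"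


section \<open>Formal concepts\<close>

definition concepts :: "'a \<Rightarrow> ('a, 'b, 'q::comm_quantale) qrel \<Rightarrow>
    (('a, 'a, 'q) qrel \<times> ('a, 'b, 'q) qrel) set"
  where "concepts star \<alpha> = {(l, s).
    is_qrel l \<and> rdom l = rdom \<alpha> \<and> rcod l = {star} \<and>
    is_qrel s \<and> rdom s = {star} \<and> rcod s = rcod \<alpha> \<and>
    l = s \<searrow> \<alpha> \<and> s = \<alpha> \<swarrow> l}"

definition concept_lattice :: "'a \<Rightarrow> ('a, 'b, 'q::comm_quantale) qrel \<Rightarrow>
    (('a, 'a, 'q) qrel \<times> ('a, 'b, 'q) qrel, 'q) qcat"
  where "concept_lattice star \<alpha> = \<lparr> rdom = concepts star \<alpha>, rcod = concepts star \<alpha>,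
    rval = (\<lambda>((l, s), (m, r))\<in>concepts star \<alpha> \<times> concepts star \<alpha>. rval (m \<swarrow> l) (star, star)) \<rparr>"

definition concept_intent :: "'a \<Rightarrow> ('a, 'b, 'q::comm_quantale) qrel \<Rightarrow>
    ('a, 'a, 'q) qrel \<times> ('a, 'b, 'q) qrel \<Rightarrow> ('a, 'b, 'q) qrel"
  where "concept_intent star \<alpha> = (\<lambda>(l, s)\<in>concepts star \<alpha>. s)"

end

theory Submission
  imports Defs
begin

text \<open>
  Since \<open>(\<tau> \<swarrow> \<sigma>) \<searrow> \<tau> = \<sigma>\<close> for every \<open>\<sigma>\<close> with a one-point domain, a morphism
  \<open>\<sigma> : \<alpha> \<rightarrow> \<tau>\<close> is just a fixed point of \<open>\<sigma> \<mapsto> \<alpha> \<swarrow> (\<sigma> \<searrow> \<alpha>)\<close>, that is, the intent of the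
  concept \<open>(\<sigma> \<searrow> \<alpha>, \<sigma>)\<close>. The homs agree by the associativity law
  \<open>\<rho> \<searrow> (\<alpha> \<swarrow> \<lambda>) = (\<rho> \<searrow> \<alpha>) \<swarrow> \<lambda>\<close>. The same law shows that precomposition with \<open>f : \<alpha> \<rightarrow> \<beta>\<close>
  is left adjoint to \<open>\<rho> \<mapsto> \<beta> \<swarrow> (\<rho> \<searrow> f)\<close>, and the colimit of the \<open>f\<close> weighted by \<open>\<phi>\<close> in a
  hom-object is the pointwise infimum of \<open>\<phi>(f) \<rightarrow> f\<close>. The functor on concept lattices is then
  the representable one conjugated by the isomorphisms.
\<close>

section \<open>Residuation\<close>

text \<open>An order-theoretic Yoneda principle: identities between residuals are compared on lower
  bounds, where the adjunction \<open>le_qimp_iff\<close> turns them into statements about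
  products.\<close>

lemma eqI_lower: "(\<And>c. c \<le> x \<longleftrightarrow> c \<le> y) \<Longrightarrow> x = y" for x y :: "'q::order"
  by (metis order.antisym order.refl)

lemma le_qimp_iff: "c \<le> a \<rightarrow>\<^sub>Q b \<longleftrightarrow> a * c \<le> b" for a b c :: "'q::comm_quantale"
  by (simp add: qimp_adjoint)

lemma qmult_mono: "a \<le> b \<Longrightarrow> c \<le> d \<Longrightarrow> a * c \<le> b * d" for a b c d :: "'q::comm_quantale"
  by (metis mult.commute order.trans qmult_right_mono)

lemma qmult_SUP: "a * (SUP i\<in>I. f i) = (SUP i\<in>I. a * f i)" for a :: "'q::comm_quantale"
  by (simp add: mult_Sup_distrib image_image)

lemma SUP_qmult: "(SUP i\<in>I. f i) * a = (SUP i\<in>I. f i * a)" for a :: "'q::comm_quantale"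
  by (simp add: mult.commute[of _ a] qmult_SUP)

lemma qimp_INF: "a \<rightarrow>\<^sub>Q (INF i\<in>I. f i) = (INF i\<in>I. a \<rightarrow>\<^sub>Q f i)" for a :: "'q::comm_quantale"
  by (rule eqI_lower) (simp add: le_qimp_iff le_INF_iff)

lemma SUP_qimp: "(SUP i\<in>I. f i) \<rightarrow>\<^sub>Q a = (INF i\<in>I. f i \<rightarrow>\<^sub>Q a)" for a :: "'q::comm_quantale"
  by (rule eqI_lower) (simp add: le_qimp_iff le_INF_iff SUP_qmult SUP_le_iff)

lemma qimp_qimp: "a \<rightarrow>\<^sub>Q (b \<rightarrow>\<^sub>Q c) = (a * b) \<rightarrow>\<^sub>Q c" for a b c :: "'q::comm_quantale"
  by (rule eqI_lower) (simp add: le_qimp_iff mult.assoc mult.left_commute)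

lemma qimp_left_commute: "a \<rightarrow>\<^sub>Q (b \<rightarrow>\<^sub>Q c) = b \<rightarrow>\<^sub>Q (a \<rightarrow>\<^sub>Q c)" for a b c :: "'q::comm_quantale"
  by (simp add: qimp_qimp mult.commute)

lemma qimp_mono: "a' \<le> a \<Longrightarrow> b \<le> b' \<Longrightarrow> a \<rightarrow>\<^sub>Q b \<le> a' \<rightarrow>\<^sub>Q b'" for a b :: "'q::comm_quantale"
  unfolding le_qimp_iff
  by (meson le_qimp_iff order.refl order.trans qmult_mono)

lemma one_qimp: "1 \<rightarrow>\<^sub>Q a = a" for a :: "'q::comm_quantale"
  by (rule eqI_lower) (simp add: le_qimp_iff)

lemma one_le_qimp_iff: "1 \<le> a \<rightarrow>\<^sub>Q b \<longleftrightarrow> a \<le> b" for a b :: "'q::comm_quantale"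
  by (simp add: le_qimp_iff)

lemma qimp_modus_ponens: "a * (a \<rightarrow>\<^sub>Q b) \<le> b" for a b :: "'q::comm_quantale"
  by (simp add: le_qimp_iff[symmetric])

lemma le_qimp_commute: "a \<le> b \<rightarrow>\<^sub>Q c \<longleftrightarrow> b \<le> a \<rightarrow>\<^sub>Q c" for a b c :: "'q::comm_quantale"
  by (simp add: le_qimp_iff mult.commute)

lemma qimp_trans: "(b \<rightarrow>\<^sub>Q c) * (a \<rightarrow>\<^sub>Q b) \<le> a \<rightarrow>\<^sub>Q c" for a b c :: "'q::comm_quantale"
proof -
  have "a * ((b \<rightarrow>\<^sub>Q c) * (a \<rightarrow>\<^sub>Q b)) = (a * (a \<rightarrow>\<^sub>Q b)) * (b \<rightarrow>\<^sub>Q c)"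
    by (simp add: mult_ac)
  also have "\<dots> \<le> b * (b \<rightarrow>\<^sub>Q c)"
    by (intro qmult_mono qimp_modus_ponens order.refl)
  also have "\<dots> \<le> c" by (rule qimp_modus_ponens)
  finally show ?thesis by (simp add: le_qimp_iff)
qed

text \<open>The composition axiom for homs that are pointwise infima of implications; it serves both
  presheaves and the hom-objects of \<open>BRel\<close>.\<close>

lemma INF_qimp_trans:
  "(INF i\<in>I. g i \<rightarrow>\<^sub>Q h i) * (INF i\<in>I. f i \<rightarrow>\<^sub>Q g i) \<le> (INF i\<in>I. f i \<rightarrow>\<^sub>Q h i)"
  for f g h :: "'i \<Rightarrow> 'q::comm_quantale"
proof (rule INF_greatest)
  fix i assume "i \<in> I"
  then show "(INF i\<in>I. g i \<rightarrow>\<^sub>Q h i) * (INF i\<in>I. f i \<rightarrow>\<^sub>Q g i) \<le> f i \<rightarrow>\<^sub>Q h i"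
    by (intro order.trans[OF qmult_mono qimp_trans[where b = "g i"]] INF_lower)
qed


section \<open>Calculus of Q-relations\<close>

lemma qrel_eqI:
  assumes "is_qrel \<alpha>" "is_qrel \<beta>" "rdom \<alpha> = rdom \<beta>" "rcod \<alpha> = rcod \<beta>"
    and "\<And>x y. x \<in> rdom \<alpha> \<Longrightarrow> y \<in> rcod \<alpha> \<Longrightarrow> rval \<alpha> (x, y) = rval \<beta> (x, y)"
  shows "\<alpha> = \<beta>"
proof -
  have "rval \<alpha> = rval \<beta>"
    by (rule extensionalityI[of _ "rdom \<alpha> \<times> rcod \<alpha>"]) (use assms in \<open>auto simp: is_qrel_def\<close>)
  with assms(3,4) show ?thesis by simp
qed

lemma qrel_sw_simps [simp]:
  "rdom (\<gamma> \<swarrow> \<alpha>) = rcod \<alpha>" "rcod (\<gamma> \<swarrow> \<alpha>) = rcod \<gamma>" "is_qrel (\<gamma> \<swarrow> \<alpha>)"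
  "y \<in> rcod \<alpha> \<Longrightarrow> z \<in> rcod \<gamma> \<Longrightarrow>
    rval (\<gamma> \<swarrow> \<alpha>) (y, z) = (INF x\<in>rdom \<alpha>. rval \<alpha> (x, y) \<rightarrow>\<^sub>Q rval \<gamma> (x, z))"
  by (simp_all add: qrel_sw_def is_qrel_def)

lemma qrel_se_simps [simp]:
  "rdom (\<beta> \<searrow> \<gamma>) = rdom \<gamma>" "rcod (\<beta> \<searrow> \<gamma>) = rdom \<beta>" "is_qrel (\<beta> \<searrow> \<gamma>)"
  "x \<in> rdom \<gamma> \<Longrightarrow> y \<in> rdom \<beta> \<Longrightarrow>
    rval (\<beta> \<searrow> \<gamma>) (x, y) = (INF z\<in>rcod \<beta>. rval \<beta> (y, z) \<rightarrow>\<^sub>Q rval \<gamma> (x, z))"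
  by (simp_all add: qrel_se_def is_qrel_def)

lemma qrel_comp_simps [simp]:
  "rdom (\<beta> \<circ>\<^sub>Q \<alpha>) = rdom \<alpha>" "rcod (\<beta> \<circ>\<^sub>Q \<alpha>) = rcod \<beta>" "is_qrel (\<beta> \<circ>\<^sub>Q \<alpha>)"
  "x \<in> rdom \<alpha> \<Longrightarrow> z \<in> rcod \<beta> \<Longrightarrow>
    rval (\<beta> \<circ>\<^sub>Q \<alpha>) (x, z) = (SUP y\<in>rcod \<alpha>. rval \<beta> (y, z) * rval \<alpha> (x, y))"
  by (simp_all add: qrel_comp_def is_qrel_def)

lemma qrel_imp_simps [simp]:
  "rdom (qrel_imp q \<alpha>) = rdom \<alpha>" "rcod (qrel_imp q \<alpha>) = rcod \<alpha>" "is_qrel (qrel_imp q \<alpha>)"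
  "x \<in> rdom \<alpha> \<Longrightarrow> y \<in> rcod \<alpha> \<Longrightarrow> rval (qrel_imp q \<alpha>) (x, y) = q \<rightarrow>\<^sub>Q rval \<alpha> (x, y)"
  by (simp_all add: qrel_imp_def is_qrel_def)

lemma qrel_le_antisym:
  "is_qrel \<alpha> \<Longrightarrow> is_qrel \<beta> \<Longrightarrow> qrel_le \<alpha> \<beta> \<Longrightarrow> qrel_le \<beta> \<alpha> \<Longrightarrow> \<alpha> = \<beta>"
  by (rule qrel_eqI) (auto simp: qrel_le_def intro: order.antisym)

text \<open>Both sides are double infima over \<open>rdom \<beta>\<close> and
  \<open>rcod \<beta>\<close> of nested implications, with the weights from
  \<open>\<upsilon>\<close> and \<open>\<mu>\<close> in opposite order; commutativity of the tensor
  exchanges them.\<close>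

lemma se_sw:
  assumes "rdom \<mu> = rdom \<beta>" "rcod \<upsilon> = rcod \<beta>"
  shows "\<upsilon> \<searrow> (\<beta> \<swarrow> \<mu>) = (\<upsilon> \<searrow> \<beta>) \<swarrow> \<mu>"
proof (rule qrel_eqI)
  fix w z assume "w \<in> rdom (\<upsilon> \<searrow> (\<beta> \<swarrow> \<mu>))" "z \<in> rcod (\<upsilon> \<searrow> (\<beta> \<swarrow> \<mu>))"
  then show "rval (\<upsilon> \<searrow> (\<beta> \<swarrow> \<mu>)) (w, z) = rval ((\<upsilon> \<searrow> \<beta>) \<swarrow> \<mu>) (w, z)"
    using assms by (simp add: qimp_INF qimp_left_commute[of "rval \<upsilon> _"] INF_commute[of _ "rcod \<beta>"])
qed simp_all

text \<open>Currying. Together with \<open>sw_sw\<close> it exhibits a composite of morphisms as a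
  residual by a single Q-relation, the form that \<open>bd_homI\<close> asks for.\<close>

lemma se_se: "rcod \<eta> = rdom \<theta> \<Longrightarrow> \<eta> \<searrow> (\<theta> \<searrow> \<sigma>) = (\<theta> \<circ>\<^sub>Q \<eta>) \<searrow> \<sigma>"
  by (rule qrel_eqI) (simp_all add: qimp_INF SUP_qimp qimp_qimp mult.commute INF_commute[of _ "rcod \<theta>"])

lemma sw_sw: "rdom \<eta> = rcod \<theta> \<Longrightarrow> (\<sigma> \<swarrow> \<theta>) \<swarrow> \<eta> = \<sigma> \<swarrow> (\<eta> \<circ>\<^sub>Q \<theta>)"
  by (rule qrel_eqI) (simp_all add: qimp_INF SUP_qimp qimp_qimp INF_commute[of _ "rdom \<theta>"])

section \<open>The antitone Galois connection induced by a Q-relation\<close>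

lemma qrel_le_se_unit: "rdom \<omega> = rdom \<beta> \<Longrightarrow> qrel_le \<omega> ((\<beta> \<swarrow> \<omega>) \<searrow> \<beta>)"
  by (auto simp: qrel_le_def le_qimp_commute[of "rval \<omega> _"] intro!: INF_greatest intro: INF_lower)

lemma qrel_le_sw_unit: "rcod \<upsilon> = rcod \<beta> \<Longrightarrow> qrel_le \<upsilon> (\<beta> \<swarrow> (\<upsilon> \<searrow> \<beta>))"
  by (auto simp: qrel_le_def le_qimp_commute[of "rval \<upsilon> _"] intro!: INF_greatest intro: INF_lower)

lemma se_antimono: "qrel_le \<upsilon> \<upsilon>' \<Longrightarrow> qrel_le (\<upsilon>' \<searrow> \<beta>) (\<upsilon> \<searrow> \<beta>)"
  by (auto simp: qrel_le_def intro!: INF_superset_mono qimp_mono)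

lemma sw_antimono: "qrel_le \<upsilon> \<upsilon>' \<Longrightarrow> qrel_le (\<beta> \<swarrow> \<upsilon>') (\<beta> \<swarrow> \<upsilon>)"
  by (auto simp: qrel_le_def intro!: INF_superset_mono qimp_mono)

text \<open>A triangle identity: one inequality is the unit at
  \<open>\<upsilon> \<searrow> \<beta>\<close>, the other is the antitone image of the unit at
  \<open>\<upsilon>\<close>.\<close>

lemma se_sw_se: "rcod \<upsilon> = rcod \<beta> \<Longrightarrow> (\<beta> \<swarrow> (\<upsilon> \<searrow> \<beta>)) \<searrow> \<beta> = \<upsilon> \<searrow> \<beta>"
  by (intro qrel_le_antisym se_antimono qrel_le_sw_unit qrel_le_se_unit) simp_all

lemma sw_se_sw: "rdom \<omega> = rdom \<beta> \<Longrightarrow> \<beta> \<swarrow> ((\<beta> \<swarrow> \<omega>) \<searrow> \<beta>) = \<beta> \<swarrow> \<omega>"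
  by (intro qrel_le_antisym sw_antimono qrel_le_sw_unit qrel_le_se_unit) simp_all

text \<open>In the infimum at \<open>(x, y)\<close> the index \<open>y\<close> itself carries the
  diagonal weight \<open>rval (\<alpha> \<swarrow> \<alpha>) (y, y)\<close>, which is at least the
  unit, so this term alone is at most \<open>rval \<alpha> (x, y)\<close>. With the dual
  \<open>sw_se_self\<close> it makes \<open>\<alpha>\<close> a morphism from itself to
  itself.\<close>

lemma sw_self_se:
  assumes "is_qrel \<alpha>" shows "(\<alpha> \<swarrow> \<alpha>) \<searrow> \<alpha> = \<alpha>"
proof (rule qrel_le_antisym)
  show "qrel_le ((\<alpha> \<swarrow> \<alpha>) \<searrow> \<alpha>) \<alpha>"
    unfolding qrel_le_def
  proof (intro conjI ballI)
    fix x y assume "x \<in> rdom ((\<alpha> \<swarrow> \<alpha>) \<searrow> \<alpha>)" and y: "y \<in> rcod ((\<alpha> \<swarrow> \<alpha>) \<searrow> \<alpha>)"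
    then have "rval ((\<alpha> \<swarrow> \<alpha>) \<searrow> \<alpha>) (x, y) \<le> rval (\<alpha> \<swarrow> \<alpha>) (y, y) \<rightarrow>\<^sub>Q rval \<alpha> (x, y)"
      by (auto intro!: INF_lower2[of y])
    also have "\<dots> \<le> 1 \<rightarrow>\<^sub>Q rval \<alpha> (x, y)"
      using y by (intro qimp_mono) (auto intro!: INF_greatest simp: one_le_qimp_iff)
    finally show "rval ((\<alpha> \<swarrow> \<alpha>) \<searrow> \<alpha>) (x, y) \<le> rval \<alpha> (x, y)"
      by (simp add: one_qimp)
  qed simp_all
qed (simp_all add: assms qrel_le_se_unit)

lemma sw_se_self:
  assumes "is_qrel \<alpha>" shows "\<alpha> \<swarrow> (\<alpha> \<searrow> \<alpha>) = \<alpha>"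
proof (rule qrel_le_antisym)
  show "qrel_le (\<alpha> \<swarrow> (\<alpha> \<searrow> \<alpha>)) \<alpha>"
    unfolding qrel_le_def
  proof (intro conjI ballI)
    fix x y assume x: "x \<in> rdom (\<alpha> \<swarrow> (\<alpha> \<searrow> \<alpha>))" and "y \<in> rcod (\<alpha> \<swarrow> (\<alpha> \<searrow> \<alpha>))"
    then have "rval (\<alpha> \<swarrow> (\<alpha> \<searrow> \<alpha>)) (x, y) \<le> rval (\<alpha> \<searrow> \<alpha>) (x, x) \<rightarrow>\<^sub>Q rval \<alpha> (x, y)"
      by (auto intro!: INF_lower2[of x])
    also have "\<dots> \<le> 1 \<rightarrow>\<^sub>Q rval \<alpha> (x, y)"
      using x by (intro qimp_mono) (auto intro!: INF_greatest simp: one_le_qimp_iff)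
    finally show "rval (\<alpha> \<swarrow> (\<alpha> \<searrow> \<alpha>)) (x, y) \<le> rval \<alpha> (x, y)"
      by (simp add: one_qimp)
  qed simp_all
qed (simp_all add: assms qrel_le_sw_unit)


section \<open>The back-diagonal category\<close>

lemma bd_homD:
  assumes "f \<in> bd_hom \<alpha> \<beta>"
  shows "is_qrel f" "rdom f = rdom \<beta>" "rcod f = rcod \<alpha>"
    "\<alpha> \<swarrow> (f \<searrow> \<alpha>) = f" "(\<beta> \<swarrow> f) \<searrow> \<beta> = f"
  using assms by (simp_all add: bd_hom_def)

text \<open>Residuals are fixed by the closure operators of the two Galois connections, by the
  triangle identities. Membership in a hom-set is thus proved by exhibiting the witnesses
  \<open>\<omega>\<close> and \<open>\<upsilon>\<close>.\<close>

lemma bd_homI: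
  assumes "f = \<alpha> \<swarrow> \<omega>" "rdom \<omega> = rdom \<alpha>" "rcod \<omega> = rdom \<beta>"
    and "f = \<upsilon> \<searrow> \<beta>" "rcod \<upsilon> = rcod \<beta>"
  shows "f \<in> bd_hom \<alpha> \<beta>"
proof -
  have "\<alpha> \<swarrow> (f \<searrow> \<alpha>) = f" unfolding assms(1) using assms by (intro sw_se_sw)
  moreover have "(\<beta> \<swarrow> f) \<searrow> \<beta> = f" unfolding assms(4) using assms by (intro se_sw_se)
  ultimately show ?thesis
    unfolding bd_hom_def using assms(2,3) by (auto simp: assms(1))
qed

text \<open>Expand \<open>g\<close> by its first closure condition, reassociate with
  \<open>se_sw\<close>, and contract \<open>f\<close> by its second one. Switching between the two
  forms of the composite drives the category laws below.\<close>

lemma bd_comp_eq_sw: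
  assumes f: "f \<in> bd_hom \<alpha> \<beta>" and g: "g \<in> bd_hom \<beta> \<gamma>"
  shows "(\<beta> \<swarrow> f) \<searrow> g = f \<swarrow> (g \<searrow> \<beta>)"
proof -
  note F = bd_homD[OF f] and G = bd_homD[OF g]
  have "(\<beta> \<swarrow> f) \<searrow> g = (\<beta> \<swarrow> f) \<searrow> (\<beta> \<swarrow> (g \<searrow> \<beta>))" by (simp add: G)
  also have "\<dots> = ((\<beta> \<swarrow> f) \<searrow> \<beta>) \<swarrow> (g \<searrow> \<beta>)" by (rule se_sw) simp_all
  also have "\<dots> = f \<swarrow> (g \<searrow> \<beta>)" by (simp add: F)
  finally show ?thesis .
qed

text \<open>Each form of the composite supplies one witness: expanding \<open>f\<close> through
  \<open>\<alpha>\<close> in the one and \<open>g\<close> through \<open>\<gamma>\<close> in the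
  other leaves iterated residuals, which collapse by \<open>sw_sw\<close> and
  \<open>se_se\<close>.\<close>

lemma bd_comp_in_hom:
  assumes f: "f \<in> bd_hom \<alpha> \<beta>" and g: "g \<in> bd_hom \<beta> \<gamma>"
  shows "(\<beta> \<swarrow> f) \<searrow> g \<in> bd_hom \<alpha> \<gamma>"
proof (rule bd_homI)
  note F = bd_homD[OF f] and G = bd_homD[OF g]
  have "(\<beta> \<swarrow> f) \<searrow> g = (\<alpha> \<swarrow> (f \<searrow> \<alpha>)) \<swarrow> (g \<searrow> \<beta>)"
    by (simp add: bd_comp_eq_sw[OF f g] F)
  also have "\<dots> = \<alpha> \<swarrow> ((g \<searrow> \<beta>) \<circ>\<^sub>Q (f \<searrow> \<alpha>))" by (rule sw_sw) (simp add: F)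
  finally show "(\<beta> \<swarrow> f) \<searrow> g = \<alpha> \<swarrow> ((g \<searrow> \<beta>) \<circ>\<^sub>Q (f \<searrow> \<alpha>))" .
  have "(\<beta> \<swarrow> f) \<searrow> g = (\<beta> \<swarrow> f) \<searrow> ((\<gamma> \<swarrow> g) \<searrow> \<gamma>)" by (simp add: G)
  also have "\<dots> = ((\<gamma> \<swarrow> g) \<circ>\<^sub>Q (\<beta> \<swarrow> f)) \<searrow> \<gamma>" by (rule se_se) (simp add: G)
  finally show "(\<beta> \<swarrow> f) \<searrow> g = ((\<gamma> \<swarrow> g) \<circ>\<^sub>Q (\<beta> \<swarrow> f)) \<searrow> \<gamma>" .
qed (simp_all add: bd_homD[OF f] bd_homD[OF g])

lemma bd_id_in_hom: "is_qrel \<alpha> \<Longrightarrow> \<alpha> \<in> bd_hom \<alpha> \<alpha>"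
  by (simp add: bd_hom_def sw_se_self sw_self_se)

text \<open>In its other form this composite is the first closure condition of
  \<open>f\<close>.\<close>

lemma bd_comp_id:
  assumes "is_qrel \<alpha>" "f \<in> bd_hom \<alpha> \<beta>"
  shows "(\<alpha> \<swarrow> \<alpha>) \<searrow> f = f"
  by (simp add: bd_comp_eq_sw[OF bd_id_in_hom assms(2)] assms(1) bd_homD[OF assms(2)])

text \<open>Once the composites with \<open>h\<close> are read in their other form, associativity is
  \<open>se_sw\<close> for the middle factor \<open>g\<close>.\<close>

lemma bd_comp_assoc:
  assumes f: "f \<in> bd_hom \<alpha> \<beta>" and g: "g \<in> bd_hom \<beta> \<gamma>" and h: "h \<in> bd_hom \<gamma> \<delta>"
  shows "(\<gamma> \<swarrow> ((\<beta> \<swarrow> f) \<searrow> g)) \<searrow> h = (\<beta> \<swarrow> f) \<searrow> ((\<gamma> \<swarrow> g) \<searrow> h)"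
proof -
  have "(\<gamma> \<swarrow> ((\<beta> \<swarrow> f) \<searrow> g)) \<searrow> h = ((\<beta> \<swarrow> f) \<searrow> g) \<swarrow> (h \<searrow> \<gamma>)"
    by (rule bd_comp_eq_sw[OF bd_comp_in_hom[OF f g] h])
  also have "\<dots> = (\<beta> \<swarrow> f) \<searrow> (g \<swarrow> (h \<searrow> \<gamma>))"
    by (rule se_sw[symmetric]) (simp_all add: bd_homD[OF g])
  also have "g \<swarrow> (h \<searrow> \<gamma>) = (\<gamma> \<swarrow> g) \<searrow> h"
    by (rule bd_comp_eq_sw[OF g h, symmetric])
  finally show ?thesis .
qed

lemma is_cat_BRel: "is_cat (BRel :: (('a, 'b, 'q::comm_quantale) qrel, ('a, 'b, 'q) qrel) cat)"
  unfolding is_cat_def BRel_def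
  using bd_comp_assoc[where ?'a = 'a and ?'b = 'b and ?'c = 'q]
  by (simp add: bd_id_in_hom bd_comp_id bd_comp_in_hom bd_homD(5))

lemma is_cat_op: "is_cat C \<Longrightarrow> is_cat (op_cat C)"
  unfolding is_cat_def op_cat_def by auto


section \<open>Cocompleteness and left adjoints\<close>

lemma is_qcatD:
  assumes "is_qcat A"
  shows "is_qrel A" "rcod A = rdom A" "x \<in> qobj A \<Longrightarrow> 1 \<le> rval A (x, x)"
    "x \<in> qobj A \<Longrightarrow> y \<in> qobj A \<Longrightarrow> z \<in> qobj A \<Longrightarrow> rval A (y, z) * rval A (x, y) \<le> rval A (x, z)"
  using assms by (simp_all add: is_qcat_def)

lemma qcat_le_of_one_le:
  assumes A: "is_qcat A" and obj: "x \<in> qobj A" "y \<in> qobj A" "z \<in> qobj A"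
  shows "1 \<le> rval A (y, z) \<Longrightarrow> rval A (x, y) \<le> rval A (x, z)"
    and "1 \<le> rval A (x, y) \<Longrightarrow> rval A (y, z) \<le> rval A (x, z)"
  using is_qcatD(4)[OF A obj] qmult_mono[of 1 "rval A (y, z)" "rval A (x, y)" "rval A (x, y)"]
    qmult_mono[of "rval A (y, z)" "rval A (y, z)" 1 "rval A (x, y)"]
  by (auto intro: order.trans)

text \<open>The hom equation at \<open>F x'\<close> turns reflexivity into a unit from
  \<open>x'\<close> to \<open>G (F x')\<close>; monotonicity of homs along the underlying preorder
  then makes \<open>F\<close> a Q-functor. The counit does the same for \<open>G\<close>.\<close>

lemma qadjointI:
  assumes A: "is_qcat A" and B: "is_qcat B" and F: "F \<in> qobj A \<rightarrow>\<^sub>E qobj B" and G: "G \<in> qobj B \<rightarrow>\<^sub>E qobj A"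
    and adj: "\<And>x y. x \<in> qobj A \<Longrightarrow> y \<in> qobj B \<Longrightarrow> rval B (F x, y) = rval A (x, G y)"
  shows "qadjoint A B F G"
proof -
  have "rval A (x, x') \<le> rval B (F x, F x')" if x: "x \<in> qobj A" "x' \<in> qobj A" for x x'
  proof -
    have "1 \<le> rval A (x', G (F x'))"
      using adj[of x' "F x'"] is_qcatD(3)[OF B, of "F x'"] x PiE_mem[OF F] by simp
    then have "rval A (x, x') \<le> rval A (x, G (F x'))"
      using x PiE_mem[OF F] PiE_mem[OF G] by (intro qcat_le_of_one_le(1)[OF A]) auto
    then show ?thesis using adj[of x "F x'"] x PiE_mem[OF F] by simp
  qed
  moreover have "rval B (y, y') \<le> rval A (G y, G y')" if y: "y \<in> qobj B" "y' \<in> qobj B" for y y'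
  proof -
    have "1 \<le> rval B (F (G y), y)"
      using adj[of "G y" y] is_qcatD(3)[OF A, of "G y"] y PiE_mem[OF G] by simp
    then have "rval B (y, y') \<le> rval B (F (G y), y')"
      using y PiE_mem[OF F] PiE_mem[OF G] by (intro qcat_le_of_one_le(2)[OF B]) auto
    then show ?thesis using adj[of "G y" y'] y PiE_mem[OF G] by simp
  qed
  ultimately show ?thesis
    unfolding qadjoint_def qfunctors_def using F G adj by auto
qed

lemma is_qcat_presheaf_qcat: "is_qcat (presheaf_qcat A)"
proof -
  have hom: "rval (\<psi> \<swarrow> \<phi>) ((), ()) = (INF x\<in>qobj A. rval \<phi> (x, ()) \<rightarrow>\<^sub>Q rval \<psi> (x, ()))"
    if "\<phi> \<in> presheaves A" "\<psi> \<in> presheaves A" for \<phi> \<psi>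
    using that by (simp add: presheaves_def)
  show ?thesis
    unfolding is_qcat_def presheaf_qcat_def
    by (auto simp: is_qrel_def hom INF_qimp_trans one_le_qimp_iff intro!: INF_greatest)
qed

lemma yoneda_simps:
  assumes "a \<in> qobj A"
  shows "is_qrel (yoneda A a)" "rdom (yoneda A a) = qobj A" "rcod (yoneda A a) = {()}"
    "x \<in> qobj A \<Longrightarrow> rval (yoneda A a) (x, ()) = rval A (x, a)"
  using assms by (simp_all add: yoneda_def is_qrel_def)

lemma yoneda_in_presheaves:
  assumes A: "is_qcat A" and a: "a \<in> qobj A"
  shows "yoneda A a \<in> presheaves A"
  using is_qcatD[OF A] a
  by (auto simp: presheaves_def yoneda_simps qrel_le_def intro!: SUP_least)

text \<open>\<open>c\<close> is the colimit of the identity of \<open>A\<close> weighted by \<open>\<phi>\<close>. Arbitrary weights in place of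
  presheaves make the condition easy to move along isomorphisms.\<close>

definition is_colimit :: "('c, 'q::comm_quantale) qcat \<Rightarrow> ('c \<Rightarrow> 'q) \<Rightarrow> 'c \<Rightarrow> bool"
  where "is_colimit A \<phi> c \<longleftrightarrow> c \<in> qobj A \<and>
    (\<forall>y\<in>qobj A. rval A (c, y) = (INF x\<in>qobj A. \<phi> x \<rightarrow>\<^sub>Q rval A (x, y)))"

lemma cocomplete_if_colimits:
  assumes A: "is_qcat A" and colim: "\<And>\<phi>. \<exists>c. is_colimit A \<phi> c"
  shows "cocomplete A"
proof -
  obtain c where c: "\<And>\<phi>. is_colimit A \<phi> (c \<phi>)" using colim by metis
  \<comment> \<open>The left adjoint of the Yoneda embedding takes a presheaf to its weighted
    colimit; the colimit equation is then literally the adjunction with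
    \<open>yoneda A a\<close>.\<close>
  define L where "L = (\<lambda>\<phi>\<in>presheaves A. c (\<lambda>x. rval \<phi> (x, ())))"
  have "qadjoint (presheaf_qcat A) A L (yoneda A)"
  proof (rule qadjointI[OF is_qcat_presheaf_qcat A])
    show "L \<in> qobj (presheaf_qcat A) \<rightarrow>\<^sub>E qobj A"
      using c by (auto simp: L_def presheaf_qcat_def is_colimit_def)
    show "yoneda A \<in> qobj A \<rightarrow>\<^sub>E qobj (presheaf_qcat A)"
      using yoneda_in_presheaves[OF A] by (auto simp: presheaf_qcat_def yoneda_def)
  next
    fix \<phi> a assume "\<phi> \<in> qobj (presheaf_qcat A)" and a: "a \<in> qobj A"
    then have \<phi>: "\<phi> \<in> presheaves A" by (simp add: presheaf_qcat_def)
    then have "rdom \<phi> = qobj A" "rcod \<phi> = {()}" by (simp_all add: presheaves_def)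
    then show "rval A (L \<phi>, a) = rval (presheaf_qcat A) (\<phi>, yoneda A a)"
      using c[of "\<lambda>x. rval \<phi> (x, ())"] a \<phi>
      by (simp add: L_def is_colimit_def presheaf_qcat_def yoneda_in_presheaves[OF A] yoneda_simps)
  qed
  then show ?thesis unfolding cocomplete_def by blast
qed

section \<open>Left adjoints and the category of skeletal cocomplete Q-categories\<close>

lemma left_adjoints_mem:
  assumes "F \<in> left_adjoints A B"
  shows "F \<in> qobj A \<rightarrow>\<^sub>E qobj B" "F \<in> extensional (qobj A)" "x \<in> qobj A \<Longrightarrow> F x \<in> qobj B"
  using assms by (auto simp: left_adjoints_def qadjoint_def qfunctors_def PiE_def)

lemma left_adjoints_compose:
  assumes A: "is_qcat A" and C: "is_qcat C"
    and "F \<in> left_adjoints A B" "G \<in> left_adjoints B C"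
  shows "compose (qobj A) G F \<in> left_adjoints A C"
proof -
  obtain F' G' where F: "qadjoint A B F F'" and G: "qadjoint B C G G'"
    using assms by (auto simp: left_adjoints_def)
  then have "qadjoint A C (compose (qobj A) G F) (compose (qobj C) F' G')"
    by (intro qadjointI[OF A C]) (auto simp: compose_eq qadjoint_def qfunctors_def PiE_iff)
  then show ?thesis by (auto simp: left_adjoints_def)
qed

lemma left_adjoints_id: "is_qcat A \<Longrightarrow> (\<lambda>x\<in>qobj A. x) \<in> left_adjoints A A"
  unfolding left_adjoints_def by (auto intro!: exI[of _ "\<lambda>x\<in>qobj A. x"] qadjointI)

lemma is_cat_QSup: "is_cat (QSup :: (('c, 'q::comm_quantale) qcat, 'c \<Rightarrow> 'c) cat)"
  unfolding is_cat_def QSup_def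
  by (auto simp: left_adjoints_id left_adjoints_compose left_adjoints_mem
      intro!: extensionalityI[of _ "qobj _"] simp: compose_eq Id_compose compose_Id
      dest: left_adjoints_mem)


section \<open>Transport along isomorphisms\<close>

text \<open>Functoriality of the inverse gives the reverse inequality between homs, so the
  isomorphism preserves homs exactly; hence it and its inverse are left adjoint to each other, and
  both are morphisms of \<open>QSup\<close>.\<close>

lemma qcat_isoE:
  assumes "qcat_iso A B F"
  obtains G where "G \<in> left_adjoints B A" "F \<in> left_adjoints A B"
    "\<And>x. x \<in> qobj A \<Longrightarrow> G (F x) = x" "\<And>y. y \<in> qobj B \<Longrightarrow> F (G y) = y"
    "\<And>x y. x \<in> qobj A \<Longrightarrow> y \<in> qobj A \<Longrightarrow> rval A (x, y) = rval B (F x, F y)"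
proof -
  from assms obtain G where A: "is_qcat A" and B: "is_qcat B" and F: "F \<in> qfunctors A B"
    and G: "G \<in> qfunctors B A"
    and GF: "\<And>x. x \<in> qobj A \<Longrightarrow> G (F x) = x" and FG: "\<And>y. y \<in> qobj B \<Longrightarrow> F (G y) = y"
    by (auto simp: qcat_iso_def)
  have F1: "F \<in> qobj A \<rightarrow>\<^sub>E qobj B" and G1: "G \<in> qobj B \<rightarrow>\<^sub>E qobj A"
    using F G by (auto simp: qfunctors_def)
  have hom: "rval A (x, y) = rval B (F x, F y)" if xy: "x \<in> qobj A" "y \<in> qobj A" for x y
  proof (rule order.antisym)
    show "rval A (x, y) \<le> rval B (F x, F y)" using F xy by (auto simp: qfunctors_def)
    have "rval B (F x, F y) \<le> rval A (G (F x), G (F y))"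
      using G PiE_mem[OF F1] xy unfolding qfunctors_def by blast
    then show "rval B (F x, F y) \<le> rval A (x, y)" using xy by (simp add: GF)
  qed
  have "rval B (F x, y) = rval A (x, G y)" "rval A (G y, x) = rval B (y, F x)"
    if "x \<in> qobj A" "y \<in> qobj B" for x y
    using that hom[of x "G y"] hom[of "G y" x] FG PiE_mem[OF G1] by auto
  then have "qadjoint A B F G" "qadjoint B A G F"
    using F1 G1 by (auto intro!: qadjointI A B)
  then have "G \<in> left_adjoints B A" "F \<in> left_adjoints A B" by (auto simp: left_adjoints_def)
  then show thesis by (rule that) (simp_all add: GF FG hom)
qed

lemma qcat_iso_cocomplete_skeletal:
  assumes iso: "qcat_iso A B F" and colim: "\<And>\<phi>. \<exists>c. is_colimit B \<phi> c" and skel: "skeletal B"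
  shows "cocomplete A" "skeletal A"
proof -
  obtain G where G: "G \<in> left_adjoints B A" and F: "F \<in> left_adjoints A B"
    and GF: "\<And>x. x \<in> qobj A \<Longrightarrow> G (F x) = x" and FG: "\<And>y. y \<in> qobj B \<Longrightarrow> F (G y) = y"
    and hom: "\<And>x y. x \<in> qobj A \<Longrightarrow> y \<in> qobj A \<Longrightarrow> rval A (x, y) = rval B (F x, F y)"
    by (rule qcat_isoE[OF iso]) (rule that)
  note F1 = left_adjoints_mem(3)[OF F] and G1 = left_adjoints_mem(3)[OF G]
  have img: "F ` qobj A = qobj B" using F1 G1 FG by (metis image_eqI image_subsetI subsetI subset_antisym)
  show "cocomplete A"
  proof (rule cocomplete_if_colimits)
    show "is_qcat A" using iso by (simp add: qcat_iso_def)
    fix \<phi>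
    \<comment> \<open>The weight is carried to \<open>B\<close> along the inverse, its colimit is
      formed there, and the result is brought back by \<open>G\<close>.\<close>
    obtain c where c: "is_colimit B (\<lambda>y. \<phi> (G y)) c" using colim by blast
    then have "is_colimit A \<phi> (G c)"
      by (auto simp: is_colimit_def hom G1 FG F1 GF img[symmetric] image_image intro!: INF_cong)
    then show "\<exists>c. is_colimit A \<phi> c" ..
  qed
  show "skeletal A"
    using skel unfolding skeletal_def by (metis hom F1 GF)
qed

lemma transport_functor:
  assumes G: "is_cfun C QSup G"
    and iso: "\<And>a. a \<in> cobj C \<Longrightarrow> qcat_iso (P a) (fobj G a) (\<eta> a)"
    and P: "\<And>a. a \<in> cobj C \<Longrightarrow> P a \<in> cobj QSup"
  shows "\<exists>F. is_cfun C QSup F \<and> fobj F = P \<and> QSup_nat_iso C F G \<eta>"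
proof -
  \<comment> \<open>All properties of the inverse sit under one existential so that choice yields a
    single family \<open>\<theta>\<close>.\<close>
  have "\<exists>t. t \<in> left_adjoints (fobj G a) (P a) \<and> \<eta> a \<in> left_adjoints (P a) (fobj G a) \<and>
    (\<forall>x\<in>qobj (P a). t (\<eta> a x) = x) \<and> (\<forall>y\<in>qobj (fobj G a). \<eta> a (t y) = y)"
    if "a \<in> cobj C" for a
    by (rule qcat_isoE[OF iso[OF that]]) blast
  then obtain \<theta> where H: "\<And>a. a \<in> cobj C \<Longrightarrow> \<theta> a \<in> left_adjoints (fobj G a) (P a) \<and>
      \<eta> a \<in> left_adjoints (P a) (fobj G a) \<and>
      (\<forall>x\<in>qobj (P a). \<theta> a (\<eta> a x) = x) \<and> (\<forall>y\<in>qobj (fobj G a). \<eta> a (\<theta> a y) = y)"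
    by metis
  have \<theta>: "\<theta> a \<in> left_adjoints (fobj G a) (P a)"
    and \<eta>: "\<eta> a \<in> left_adjoints (P a) (fobj G a)"
    and \<theta>\<eta>: "\<And>x. x \<in> qobj (P a) \<Longrightarrow> \<theta> a (\<eta> a x) = x"
    and \<eta>\<theta>: "\<And>y. y \<in> qobj (fobj G a) \<Longrightarrow> \<eta> a (\<theta> a y) = y"
    if "a \<in> cobj C" for a
    using H[OF that] by auto
  \<comment> \<open>Both compositions are restricted to \<open>qobj (P a)\<close>, so the action on
    morphisms is extensional and equalities can be checked pointwise.\<close>
  define F where "F = \<lparr> fobj = P,
    fmor = (\<lambda>a b f. compose (qobj (P a)) (\<theta> b) (compose (qobj (P a)) (fmor G a b f) (\<eta> a))) \<rparr>"
  have C: "is_cat C"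
    and Gmor: "\<And>a b f. a \<in> cobj C \<Longrightarrow> b \<in> cobj C \<Longrightarrow> f \<in> chom C a b \<Longrightarrow>
        fmor G a b f \<in> left_adjoints (fobj G a) (fobj G b)"
    and Gid: "\<And>a. a \<in> cobj C \<Longrightarrow> fmor G a a (cid C a) = (\<lambda>x\<in>qobj (fobj G a). x)"
    and Gcomp: "\<And>a b c f g. a \<in> cobj C \<Longrightarrow> b \<in> cobj C \<Longrightarrow> c \<in> cobj C \<Longrightarrow>
        f \<in> chom C a b \<Longrightarrow> g \<in> chom C b c \<Longrightarrow>
        fmor G a c (ccomp C a b c g f) = compose (qobj (fobj G a)) (fmor G b c g) (fmor G a b f)"
    using G by (simp_all add: is_cfun_def QSup_def)
  have qP: "is_qcat (P a)" and qG: "is_qcat (fobj G a)" if "a \<in> cobj C" for a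
    using iso[OF that] by (auto simp: qcat_iso_def)
  note \<theta>1 = left_adjoints_mem(3)[OF \<theta>] and \<eta>1 = left_adjoints_mem(3)[OF \<eta>]
    and G1 = left_adjoints_mem(3)[OF Gmor]
  have Fmor: "fmor F a b f \<in> left_adjoints (P a) (P b)"
    if "a \<in> cobj C" "b \<in> cobj C" "f \<in> chom C a b" for a b f
    using left_adjoints_compose[OF qP qP left_adjoints_compose[OF qP qG \<eta> Gmor] \<theta>] that
    by (simp add: F_def)
  have Fval: "fmor F a b f x = \<theta> b (fmor G a b f (\<eta> a x))" if "x \<in> qobj (P a)" for a b f x
    using that by (simp add: F_def compose_eq)
  have Fext: "fmor F a b f \<in> extensional (qobj (P a))" for a b f
    by (simp add: F_def)
  have "is_cfun C QSup F"
    unfolding is_cfun_def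
  proof (intro conjI ballI C is_cat_QSup)
    fix a assume a: "a \<in> cobj C"
    show "fobj F a \<in> cobj QSup" using P[OF a] by (simp add: F_def)
    have "fmor F a a (cid C a) = (\<lambda>x\<in>qobj (P a). x)"
      by (rule extensionalityI[of _ "qobj (P a)"]) (simp_all add: Fext Fval Gid a \<eta>1 \<theta>\<eta>)
    then show "fmor F a a (cid C a) = cid QSup (fobj F a)" by (simp add: F_def QSup_def)
  next
    fix a b f assume "a \<in> cobj C" "b \<in> cobj C" "f \<in> chom C a b"
    then show "fmor F a b f \<in> chom QSup (fobj F a) (fobj F b)"
      using Fmor[of a b f] by (simp add: QSup_def F_def)
  next
    fix a b c f g
    assume H: "a \<in> cobj C" "b \<in> cobj C" "c \<in> cobj C" "f \<in> chom C a b" "g \<in> chom C b c"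
    have "fmor F a c (ccomp C a b c g f) = compose (qobj (P a)) (fmor F b c g) (fmor F a b f)"
    proof (rule extensionalityI[of _ "qobj (P a)"])
      fix x assume x: "x \<in> qobj (P a)"
      \<comment> \<open>This membership is what lets the inner pair \<open>\<eta> b\<close>,
        \<open>\<theta> b\<close> cancel between the two conjugated maps.\<close>
      have y: "fmor G a b f (\<eta> a x) \<in> qobj (fobj G b)" using H x by (auto intro: G1 \<eta>1)
      then show "fmor F a c (ccomp C a b c g f) x = compose (qobj (P a)) (fmor F b c g) (fmor F a b f) x"
        using H x by (simp add: Fval Gcomp compose_eq \<eta>1 \<theta>1 \<eta>\<theta>)
    qed (simp_all add: Fext)
    then show "fmor F a c (ccomp C a b c g f) =
      ccomp QSup (fobj F a) (fobj F b) (fobj F c) (fmor F b c g) (fmor F a b f)"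
      by (simp add: QSup_def F_def)
  qed
  moreover have "compose (qobj (P a)) (fmor G a b f) (\<eta> a) = compose (qobj (P a)) (\<eta> b) (fmor F a b f)"
    if H: "a \<in> cobj C" "b \<in> cobj C" "f \<in> chom C a b" for a b f
    by (rule extensionalityI[of _ "qobj (P a)"])
      (use H in \<open>simp_all add: compose_eq Fval \<eta>\<theta> G1 \<eta>1\<close>)
  moreover have "fobj F = P" by (simp add: F_def)
  moreover have "\<exists>t\<in>left_adjoints (fobj G a) (P a).
      (\<forall>x\<in>qobj (P a). t (\<eta> a x) = x) \<and> (\<forall>y\<in>qobj (fobj G a). \<eta> a (t y) = y)"
    if "a \<in> cobj C" for a
    using that \<theta> \<theta>\<eta> \<eta>\<theta> by (intro bexI[of _ "\<theta> a"]) auto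
  ultimately show ?thesis
    unfolding QSup_nat_iso_def using G \<eta> by (intro exI[of _ F]) simp
qed


section \<open>The representable functor\<close>

lemma BRel_hom_obj [simp]: "qobj (BRel_hom \<alpha> \<beta>) = bd_hom \<alpha> \<beta>"
  by (simp add: BRel_hom_def module_qcat_def BRel_def)

text \<open>The scalars in the defining join are exactly those below the infimum, so the join equals
  it. The opposite order on the hom-set is what puts \<open>g\<close> in the antecedent.\<close>

lemma BRel_hom_val:
  assumes f: "f \<in> bd_hom \<alpha> \<beta>" and g: "g \<in> bd_hom \<alpha> \<beta>"
  shows "rval (BRel_hom \<alpha> \<beta>) (f, g) =
    (INF z\<in>rdom \<beta> \<times> rcod \<alpha>. rval g z \<rightarrow>\<^sub>Q rval f z)"
proof -
  have "{q. qrel_le g (qrel_imp q f)} = {q. q \<le> (INF z\<in>rdom \<beta> \<times> rcod \<alpha>. rval g z \<rightarrow>\<^sub>Q rval f z)}"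
    using bd_homD(2,3)[OF f] bd_homD(2,3)[OF g]
    by (auto simp: qrel_le_def le_INF_iff le_qimp_iff mult.commute)
  then show ?thesis
    using f g by (simp add: BRel_hom_def module_qcat_def BRel_def atMost_def[symmetric])
qed

lemma is_qcat_BRel_hom: "is_qcat (BRel_hom \<alpha> \<beta>)"
proof -
  have "rcod (BRel_hom \<alpha> \<beta>) = bd_hom \<alpha> \<beta>" "is_qrel (BRel_hom \<alpha> \<beta>)"
    by (simp_all add: BRel_hom_def module_qcat_def BRel_def is_qrel_def)
  moreover have "rval (BRel_hom \<alpha> \<beta>) (g, h) * rval (BRel_hom \<alpha> \<beta>) (f, g) \<le> rval (BRel_hom \<alpha> \<beta>) (f, h)"
    if "f \<in> bd_hom \<alpha> \<beta>" "g \<in> bd_hom \<alpha> \<beta>" "h \<in> bd_hom \<alpha> \<beta>" for f g h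
    using INF_qimp_trans[of "rval g" "rval f" _ "rval h"] that
    by (simp add: BRel_hom_val mult.commute)
  ultimately show ?thesis
    by (auto simp: is_qcat_def BRel_hom_val one_le_qimp_iff intro!: INF_greatest)
qed

lemma skeletal_BRel_hom: "skeletal (BRel_hom \<alpha> \<beta>)"
  unfolding skeletal_def
proof (clarsimp simp: BRel_hom_val le_INF_iff one_le_qimp_iff)
  fix f g assume fg: "f \<in> bd_hom \<alpha> \<beta>" "g \<in> bd_hom \<alpha> \<beta>"
    and "\<forall>x\<in>rdom \<beta>. \<forall>y\<in>rcod \<alpha>. rval g (x, y) \<le> rval f (x, y)"
      "\<forall>x\<in>rdom \<beta>. \<forall>y\<in>rcod \<alpha>. rval f (x, y) \<le> rval g (x, y)"
  then show "f = g"
    using bd_homD(1-3)[OF fg(1)] bd_homD(1-3)[OF fg(2)]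
    by (intro qrel_le_antisym) (auto simp: qrel_le_def)
qed

lemma BRel_hom_colimit: "\<exists>c. is_colimit (BRel_hom \<alpha> \<beta>) \<phi> c"
proof -
  define c where "c = \<lparr> rdom = rdom \<beta>, rcod = rcod \<alpha>,
    rval = (\<lambda>z\<in>rdom \<beta> \<times> rcod \<alpha>. INF f\<in>bd_hom \<alpha> \<beta>. \<phi> f \<rightarrow>\<^sub>Q rval f z) \<rparr>"
  have c: "is_qrel c" "rdom c = rdom \<beta>" "rcod c = rcod \<alpha>"
    and cval: "\<And>z. z \<in> rdom \<beta> \<times> rcod \<alpha> \<Longrightarrow> rval c z = (INF f\<in>bd_hom \<alpha> \<beta>. \<phi> f \<rightarrow>\<^sub>Q rval f z)"
    by (simp_all add: c_def is_qrel_def)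
  \<comment> \<open>The witnesses \<open>u\<close> and \<open>v\<close> are the joins, weighted by
    \<open>\<phi>\<close>, of the residuals through which each \<open>f\<close> is closed.
    Implication turns these joins into infima, so \<open>\<alpha> \<swarrow> u\<close> and
    \<open>v \<searrow> \<beta>\<close> both become the infimum of
    \<open>\<phi> f \<rightarrow>\<^sub>Q rval f z\<close>.\<close>
  define u where "u = \<lparr> rdom = rdom \<alpha>, rcod = rdom \<beta>,
    rval = (\<lambda>(x, x'). SUP f\<in>bd_hom \<alpha> \<beta>. \<phi> f * rval (f \<searrow> \<alpha>) (x, x')) \<rparr>"
  define v where "v = \<lparr> rdom = rcod \<alpha>, rcod = rcod \<beta>,
    rval = (\<lambda>(y, y'). SUP f\<in>bd_hom \<alpha> \<beta>. \<phi> f * rval (\<beta> \<swarrow> f) (y, y')) \<rparr>"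
  have cu: "c = \<alpha> \<swarrow> u"
  proof (rule qrel_eqI)
    fix x y assume "x \<in> rdom c" "y \<in> rcod c"
    then have xy: "x \<in> rdom \<beta>" "y \<in> rcod \<alpha>" by (simp_all add: c)
    have "rval f (x, y) = (INF z\<in>rdom \<alpha>. rval (f \<searrow> \<alpha>) (z, x) \<rightarrow>\<^sub>Q rval \<alpha> (z, y))"
      if "f \<in> bd_hom \<alpha> \<beta>" for f
      using qrel_sw_simps(4)[of x "f \<searrow> \<alpha>" y \<alpha>] xy bd_homD[OF that] by simp
    then show "rval c (x, y) = rval (\<alpha> \<swarrow> u) (x, y)"
      using xy by (simp add: cval u_def qimp_INF SUP_qimp qimp_qimp INF_commute[of _ "rdom \<alpha>"] cong: INF_cong_simp)
  qed (simp_all add: c u_def)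
  have cv: "c = v \<searrow> \<beta>"
  proof (rule qrel_eqI)
    fix x y assume "x \<in> rdom c" "y \<in> rcod c"
    then have xy: "x \<in> rdom \<beta>" "y \<in> rcod \<alpha>" by (simp_all add: c)
    have "rval f (x, y) = (INF z\<in>rcod \<beta>. rval (\<beta> \<swarrow> f) (y, z) \<rightarrow>\<^sub>Q rval \<beta> (x, z))"
      if "f \<in> bd_hom \<alpha> \<beta>" for f
      using qrel_se_simps(4)[of x \<beta> y "\<beta> \<swarrow> f"] xy bd_homD[OF that] by simp
    then show "rval c (x, y) = rval (v \<searrow> \<beta>) (x, y)"
      using xy by (simp add: cval v_def qimp_INF SUP_qimp qimp_qimp INF_commute[of _ "rcod \<beta>"] cong: INF_cong_simp)
  qed (simp_all add: c v_def)
  have hom: "c \<in> bd_hom \<alpha> \<beta>"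
    by (rule bd_homI[OF cu _ _ cv]) (simp_all add: u_def v_def)
  \<comment> \<open>The weight \<open>\<phi> f\<close> and the entry of \<open>g\<close> trade
    places as antecedents, and the infimum over \<open>f\<close> is exchanged with the one over
    entries.\<close>
  have "rval (BRel_hom \<alpha> \<beta>) (c, g) = (INF f\<in>bd_hom \<alpha> \<beta>. \<phi> f \<rightarrow>\<^sub>Q rval (BRel_hom \<alpha> \<beta>) (f, g))"
    if "g \<in> bd_hom \<alpha> \<beta>" for g
    using that hom
    by (simp add: BRel_hom_val cval qimp_INF qimp_left_commute[of "rval g _"]
        INF_commute[of _ "rdom \<beta> \<times> rcod \<alpha>"] cong: INF_cong_simp)
  with hom show ?thesis by (auto simp: is_colimit_def)
qed

lemma BRel_hom_in_QSup: "BRel_hom \<alpha> \<beta> \<in> cobj QSup"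
  by (simp add: QSup_def is_qcat_BRel_hom skeletal_BRel_hom cocomplete_if_colimits BRel_hom_colimit)

section \<open>Hom-objects into \<open>tau\<close>\<close>

context
  fixes star :: 'a and emb :: "'q::comm_quantale \<Rightarrow> 'b"
  assumes inj_emb: "inj emb"
begin

private abbreviation (input) \<tau> :: "('a, 'b, 'q) qrel" where "\<tau> \<equiv> tau star emb"

lemma tau_simps [simp]: "rdom \<tau> = {star}" "rcod \<tau> = range emb" "rval \<tau> (star, emb q) = q"
  by (simp_all add: tau_def the_inv_f_f[OF inj_emb])

text \<open>The infimum over \<open>q\<close> of \<open>(a \<rightarrow> q) \<rightarrow> q\<close> is \<open>a\<close>, attained at \<open>q = a\<close>. So the second
  condition on morphisms into \<open>\<tau>\<close> is vacuous.\<close>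

lemma tau_closed:
  assumes "is_qrel f" "rdom f = {star}"
  shows "(\<tau> \<swarrow> f) \<searrow> \<tau> = f"
proof (rule qrel_le_antisym)
  show "qrel_le ((\<tau> \<swarrow> f) \<searrow> \<tau>) f"
    unfolding qrel_le_def
  proof (intro conjI ballI)
    fix x y assume "x \<in> rdom ((\<tau> \<swarrow> f) \<searrow> \<tau>)" and "y \<in> rcod ((\<tau> \<swarrow> f) \<searrow> \<tau>)"
    then have x: "x = star" and y: "y \<in> rcod f" by simp_all
    let ?a = "rval f (star, y)"
    have "rval ((\<tau> \<swarrow> f) \<searrow> \<tau>) (star, y) \<le> (?a \<rightarrow>\<^sub>Q ?a) \<rightarrow>\<^sub>Q ?a"
      using y by (simp add: assms image_image) (rule INF_lower2[of ?a]; simp)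
    also have "\<dots> \<le> 1 \<rightarrow>\<^sub>Q ?a"
      by (intro qimp_mono) (simp_all add: one_le_qimp_iff)
    finally show "rval ((\<tau> \<swarrow> f) \<searrow> \<tau>) (x, y) \<le> rval f (x, y)"
      by (simp add: one_qimp x)
  qed (simp_all add: assms)
qed (simp_all add: assms qrel_le_se_unit)

lemma bd_hom_tau_iff:
  "s \<in> bd_hom \<alpha> \<tau> \<longleftrightarrow> is_qrel s \<and> rdom s = {star} \<and> rcod s = rcod \<alpha> \<and> \<alpha> \<swarrow> (s \<searrow> \<alpha>) = s"
  by (auto simp: bd_hom_def tau_closed)

lemma BRel_hom_tau_val:
  assumes "s \<in> bd_hom \<alpha> \<tau>" "r \<in> bd_hom \<alpha> \<tau>"
  shows "rval (BRel_hom \<alpha> \<tau>) (s, r) = rval (r \<searrow> s) (star, star)"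
proof -
  have "{star} \<times> rcod \<alpha> = Pair star ` rcod \<alpha>" by auto
  then show ?thesis
    using assms by (simp add: BRel_hom_val bd_homD[OF assms(1)] bd_homD[OF assms(2)] image_image)
qed

lemma precomp_left_adjoint:
  assumes f: "f \<in> bd_hom \<alpha> \<beta>"
  shows "(\<lambda>\<sigma>\<in>bd_hom \<beta> \<tau>. (\<beta> \<swarrow> f) \<searrow> \<sigma>) \<in> left_adjoints (BRel_hom \<beta> \<tau>) (BRel_hom \<alpha> \<tau>)"
proof -
  note F = bd_homD[OF f]
  let ?R = "\<lambda>g. \<beta> \<swarrow> (g \<searrow> f)"
  have R: "?R g \<in> bd_hom \<beta> \<tau>" if "g \<in> bd_hom \<alpha> \<tau>" for g
    using bd_homD[OF that] F by (auto simp: bd_hom_tau_iff sw_se_sw)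
  have key: "g \<searrow> ((\<beta> \<swarrow> f) \<searrow> \<sigma>) = ?R g \<searrow> \<sigma>"
    if \<sigma>: "\<sigma> \<in> bd_hom \<beta> \<tau>" and g: "g \<in> bd_hom \<alpha> \<tau>" for \<sigma> g
  proof -
    note S = bd_homD[OF \<sigma>] and G = bd_homD[OF g]
    let ?l = "\<sigma> \<searrow> \<beta>"
    have gf: "g \<searrow> f = ((\<beta> \<swarrow> f) \<circ>\<^sub>Q g) \<searrow> \<beta>"
      using se_se[of g "\<beta> \<swarrow> f" \<beta>] F G by simp
    have "g \<searrow> ((\<beta> \<swarrow> f) \<searrow> \<sigma>) = g \<searrow> (f \<swarrow> ?l)"
      by (simp add: bd_comp_eq_sw[OF f \<sigma>])
    also have "\<dots> = (g \<searrow> f) \<swarrow> ?l" using F G by (intro se_sw) simp_all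
    \<comment> \<open>By \<open>gf\<close>, \<open>g \<searrow> f\<close> is itself a residual into
      \<open>\<beta>\<close>, hence closed; this is what brings in the candidate right adjoint
      \<open>?R g\<close>.\<close>
    also have "g \<searrow> f = ?R g \<searrow> \<beta>" unfolding gf by (rule se_sw_se[symmetric]) simp
    also have "(?R g \<searrow> \<beta>) \<swarrow> ?l = ?R g \<searrow> (\<beta> \<swarrow> ?l)" by (rule se_sw[symmetric]) simp_all
    also have "\<dots> = ?R g \<searrow> \<sigma>" by (simp add: S)
    finally show ?thesis .
  qed
  \<comment> \<open>\<open>BRel_hom_tau_val\<close> reduces the hom equation to \<open>key\<close>;
    expanding residuals into infima is switched off so that \<open>key\<close> can match.\<close>
  have "qadjoint (BRel_hom \<beta> \<tau>) (BRel_hom \<alpha> \<tau>)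
      (\<lambda>\<sigma>\<in>bd_hom \<beta> \<tau>. (\<beta> \<swarrow> f) \<searrow> \<sigma>) (\<lambda>g\<in>bd_hom \<alpha> \<tau>. ?R g)"
    using bd_comp_in_hom[OF f] R key
    by (intro qadjointI is_qcat_BRel_hom) (auto simp del: qrel_se_simps(4) simp: BRel_hom_tau_val)
  then show ?thesis by (auto simp: left_adjoints_def)
qed

text \<open>Preservation of identities and of composites is \<open>bd_comp_id\<close> and
  \<open>bd_comp_assoc\<close>, read as equalities of extensional maps on hom-sets.\<close>

lemma is_cfun_BRel_repr: "is_cfun (op_cat BRel) QSup (BRel_repr star emb)"
proof -
  have "(\<lambda>\<sigma>\<in>bd_hom \<alpha> \<tau>. (\<alpha> \<swarrow> \<alpha>) \<searrow> \<sigma>) = (\<lambda>\<sigma>\<in>bd_hom \<alpha> \<tau>. \<sigma>)" if "is_qrel \<alpha>" for \<alpha>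
    using that by (intro restrict_ext bd_comp_id)
  moreover have "(\<lambda>\<sigma>\<in>bd_hom \<gamma> \<tau>. (\<gamma> \<swarrow> ((\<beta> \<swarrow> f) \<searrow> g)) \<searrow> \<sigma>) =
    compose (bd_hom \<gamma> \<tau>) (\<lambda>\<sigma>\<in>bd_hom \<beta> \<tau>. (\<beta> \<swarrow> f) \<searrow> \<sigma>) (\<lambda>\<sigma>\<in>bd_hom \<gamma> \<tau>. (\<gamma> \<swarrow> g) \<searrow> \<sigma>)"
    if "f \<in> bd_hom \<alpha> \<beta>" "g \<in> bd_hom \<beta> \<gamma>" for \<alpha> \<beta> \<gamma> f g
    unfolding compose_def using that by (intro restrict_ext) (simp add: bd_comp_assoc bd_comp_in_hom)
  ultimately show ?thesis
    unfolding is_cfun_def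
    using precomp_left_adjoint BRel_hom_in_QSup[of _ \<tau>]
    by (intro conjI is_cat_op is_cat_BRel is_cat_QSup) (simp_all add: op_cat_def BRel_def BRel_repr_def QSup_def)
qed

lemma concept_lattice_iso:
  "qcat_iso (concept_lattice star \<alpha>) (BRel_hom \<alpha> \<tau>) (concept_intent star \<alpha>)"
proof -
  let ?A = "concept_lattice star \<alpha>" and ?B = "BRel_hom \<alpha> \<tau>"
  \<comment> \<open>The extent is determined by the intent, so every later claim about concepts can
    be stated for a morphism \<open>s\<close> into \<open>tau\<close> alone.\<close>
  have concepts: "concepts star \<alpha> = (\<lambda>s. (s \<searrow> \<alpha>, s)) ` bd_hom \<alpha> \<tau>"
    by (auto simp: concepts_def bd_hom_tau_iff image_iff)
  have obj: "qobj ?A = concepts star \<alpha>" and cod: "rcod ?A = concepts star \<alpha>" and qrel: "is_qrel ?A"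
    by (simp_all add: concept_lattice_def is_qrel_def)
  have hom: "rval ?A ((s \<searrow> \<alpha>, s), (r \<searrow> \<alpha>, r)) = rval ?B (s, r)"
    if s: "s \<in> bd_hom \<alpha> \<tau>" and r: "r \<in> bd_hom \<alpha> \<tau>" for s r
  proof -
    have "rval ?A ((s \<searrow> \<alpha>, s), (r \<searrow> \<alpha>, r)) = rval ((r \<searrow> \<alpha>) \<swarrow> (s \<searrow> \<alpha>)) (star, star)"
      using s r by (simp add: concept_lattice_def concepts)
    also have "(r \<searrow> \<alpha>) \<swarrow> (s \<searrow> \<alpha>) = r \<searrow> (\<alpha> \<swarrow> (s \<searrow> \<alpha>))"
      using bd_homD[OF r] by (intro se_sw[symmetric]) simp_all
    also have "\<alpha> \<swarrow> (s \<searrow> \<alpha>) = s" by (rule bd_homD(4)[OF s])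
    finally show ?thesis using s r by (simp add: BRel_hom_tau_val)
  qed
  have intent: "concept_intent star \<alpha> (s \<searrow> \<alpha>, s) = s" if "s \<in> bd_hom \<alpha> \<tau>" for s
    using that by (simp add: concept_intent_def concepts)
  have B: "is_qcat ?B" by (rule is_qcat_BRel_hom)
  have "is_qcat ?A"
    using is_qcatD(3,4)[OF B] by (auto simp: is_qcat_def obj cod qrel concepts hom)
  moreover have "concept_intent star \<alpha> \<in> qfunctors ?A ?B"
    by (auto simp: qfunctors_def obj concepts hom intent concept_intent_def)
  moreover have "(\<lambda>s\<in>bd_hom \<alpha> \<tau>. (s \<searrow> \<alpha>, s)) \<in> qfunctors ?B ?A"
    by (auto simp: qfunctors_def obj concepts hom)
  ultimately show ?thesis
    unfolding qcat_iso_def using B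
    by (auto simp: obj concepts intent intro!: bexI[of _ "\<lambda>s\<in>bd_hom \<alpha> \<tau>. (s \<searrow> \<alpha>, s)"])
qed

end

theorem theorem3p3:
  fixes star :: 'a and emb :: "'q::comm_quantale \<Rightarrow> 'b"
  assumes "inj emb"
  shows "(\<forall>\<alpha> :: ('a, 'b, 'q) qrel. is_qrel \<alpha> \<longrightarrow>
      qcat_iso (concept_lattice star \<alpha>) (BRel_hom \<alpha> (tau star emb)) (concept_intent star \<alpha>)) \<and>
    (\<exists>F. is_cfun (op_cat BRel) QSup F \<and>
      (\<forall>\<alpha> :: ('a, 'b, 'q) qrel. is_qrel \<alpha> \<longrightarrow> fobj F \<alpha> = concept_lattice star \<alpha>) \<and>
      QSup_nat_iso (op_cat BRel) F (BRel_repr star emb) (concept_intent star))"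
proof -
  note iso = concept_lattice_iso[OF assms]
  \<comment> \<open>Skeletality and cocompleteness are inherited from the hom-object through the
    isomorphism.\<close>
  have "concept_lattice star \<alpha> \<in> cobj QSup" for \<alpha> :: "('a, 'b, 'q) qrel"
    using qcat_iso_cocomplete_skeletal[OF iso[of star \<alpha>] BRel_hom_colimit skeletal_BRel_hom]
      iso[of star \<alpha>]
    by (simp add: QSup_def qcat_iso_def)
  then have "\<exists>F. is_cfun (op_cat BRel) QSup F \<and> fobj F = concept_lattice star \<and>
      QSup_nat_iso (op_cat BRel) F (BRel_repr star emb) (concept_intent star)"
    using is_cfun_BRel_repr[OF assms] iso
    by (intro transport_functor) (simp_all add: BRel_repr_def)
  then show ?thesis using iso by auto
qed

end
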